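(* $\mathrm{yield}(\mathrm{RECOG})=\mathrm{CFL}$. That is: for every recognizable tree language $L$ the string language $\mathrm{yield}(L)$ is context-free, and for every context-free language $K$ there is a recognizable tree language $L$ with $\mathrm{yield}(L)=K$.
   Context: Alphabets are finite. A ranked alphabet $\Sigma$ is a finite set of symbols together with, for each $k\ge 0$, a subset $\Sigma_k\subseteq\Sigma$ (the symbols of rank $k$; a symbol may have several ranks), with $\Sigma=\bigcup_k\Sigma_k$ and only finitely many $\Sigma_k$ nonempty. The brackets $[$ and $]$ never belong to a ranked alphabet. The set $T_\Sigma$ of trees over $\Sigma$ is the smallest set of strings such that $a\in T_\Sigma$ for $a\in\Sigma_0$, and $a[t_1\cdots t_k]\in T_\Sigma$ for $k\ge1$, $a\in\Sigma_k$, $t_1,\dots,t_k\in T_\Sigma$ (finite ordered labelled trees). A tree language over $\Sigma$ is a subset of $T_\Sigma$. $e$ is a special reserved symbol representing the empty string $\lambda$; whenever it belongs to a ranked alphabet it has rank $0$ (only). It is not a symbol of the alphabets of string languages, and neither are the brackets. The map $\mathrm{yield}:T_\Sigma\to\Sigma_0^*$ is defined by $\mathrm{yield}(a)=a$ for $a\in\Sigma_0$, $a\ne e$; $\mathrm{yield}(e)=\lambda$; $\mathrm{yield}(a[t_1\cdots t_k])=\mathrm{yield}(t_1)\cdots\mathrm{yield}(t_k)$. For $L\subseteq T_\Sigma$, $\mathrm{yield}(L)=\{\mathrm{yield}(t)\mid t\in L\}$. A deterministic bottom-up finite tree automaton $M=(Q,\Sigma,\delta,s,F)$ has a finite state set $Q$,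 a ranked alphabet $\Sigma$, maps $\delta_a^k:Q^k\to Q$ for $k\ge1$, $a\in\Sigma_k$, states $s_a\in Q$ for $a\in\Sigma_0$, and $F\subseteq Q$. Define $\widehat\delta:T_\Sigma\to Q$ by $\widehat\delta(a)=s_a$ and $\widehat\delta(a[t_1\cdots t_k])=\delta^k_a(\widehat\delta(t_1),\dots,\widehat\delta(t_k))$; $L(M)=\{t\in T_\Sigma\mid\widehat\delta(t)\in F\}$. A tree language is recognizable if it equals $L(M)$ for some such $M$; RECOG is the class of recognizable tree languages. CFL is the class of context-free (string) languages. *)

theory Defs
  imports Main
begin

section \<open>Ranked alphabets and trees\<close>

text \<open>Symbols of tree alphabets are drawn from the ordinary symbols \<open>Sym x\<close>, with \<open>x\<close> in an
  arbitrary type, together with the reserved symbol \<open>e\<close>, here \<open>Eps\<close>. Strings are lists over the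
  underlying type, so \<open>e\<close> cannot occur in a string.\<close>

datatype 'a symbol = Eps | Sym 'a

text \<open>A ranked alphabet is given by the family of its sets \<open>\<Sigma>\<^sub>k\<close> of symbols of rank \<open>k\<close>; the set of
  all its symbols is their union.\<close>

type_synonym 'a ranked = "nat \<Rightarrow> 'a symbol set"

definition ranked_alphabet :: "'a ranked \<Rightarrow> bool" where
  "ranked_alphabet \<Sigma> \<longleftrightarrow>
     finite (\<Union>k. \<Sigma> k) \<and> finite {k. \<Sigma> k \<noteq> {}} \<and> (\<forall>k\<ge>1. Eps \<notin> \<Sigma> k)"

text \<open>\<open>Node a []\<close> is the one-symbol string \<open>a\<close>, and \<open>Node a [t\<^sub>1, \<dots>, t\<^sub>k]\<close> with \<open>k \<ge> 1\<close> is the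
  string \<open>a[t\<^sub>1\<cdots>t\<^sub>k]\<close>. Since the brackets are not symbols, such strings are uniquely readable, and
  the datatype represents them faithfully.\<close>

datatype 's tree = Node 's "'s tree list"

inductive_set trees :: "'a ranked \<Rightarrow> 'a symbol tree set" for \<Sigma> :: "'a ranked" where
  leaf: "a \<in> \<Sigma> 0 \<Longrightarrow> Node a [] \<in> trees \<Sigma>"
| node: "\<lbrakk>length ts = k; k \<ge> 1; a \<in> \<Sigma> k; \<forall>t\<in>set ts. t \<in> trees \<Sigma>\<rbrakk> \<Longrightarrow> Node a ts \<in> trees \<Sigma>"

fun symbol_word :: "'a symbol \<Rightarrow> 'a list" where
  "symbol_word Eps = []"
| "symbol_word (Sym x) = [x]"

fun yield :: "'a symbol tree \<Rightarrow> 'a list" where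
  "yield (Node a ts) = (if ts = [] then symbol_word a else concat (map yield ts))"


section \<open>Deterministic bottom-up finite tree automata\<close>

text \<open>\<open>dta_delta M a [q\<^sub>1, \<dots>, q\<^sub>k]\<close> is \<open>\<delta>\<^sub>a\<^sup>k(q\<^sub>1, \<dots>, q\<^sub>k)\<close>: the rank \<open>k\<close> is the length of the argument
  list. Values outside the ranked alphabet and the state set are irrelevant.\<close>

record ('q, 'a) dta =
  dta_states :: "'q set"
  dta_alphabet :: "'a ranked"
  dta_delta :: "'a symbol \<Rightarrow> 'q list \<Rightarrow> 'q"
  dta_init :: "'a symbol \<Rightarrow> 'q"
  dta_final :: "'q set"

definition dta :: "('q, 'a) dta \<Rightarrow> bool" where
  "dta M \<longleftrightarrow>
     finite (dta_states M) \<and>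
     ranked_alphabet (dta_alphabet M) \<and>
     (\<forall>k\<ge>1. \<forall>a\<in>dta_alphabet M k. \<forall>qs. length qs = k \<and> set qs \<subseteq> dta_states M \<longrightarrow>
        dta_delta M a qs \<in> dta_states M) \<and>
     (\<forall>a\<in>dta_alphabet M 0. dta_init M a \<in> dta_states M) \<and>
     dta_final M \<subseteq> dta_states M"

fun delta_hat :: "('q, 'a) dta \<Rightarrow> 'a symbol tree \<Rightarrow> 'q" where
  "delta_hat M (Node a ts) =
     (if ts = [] then dta_init M a else dta_delta M a (map (delta_hat M) ts))"

definition dta_lang :: "('q, 'a) dta \<Rightarrow> 'a symbol tree set" where
  "dta_lang M = {t \<in> trees (dta_alphabet M). delta_hat M t \<in> dta_final M}"

text \<open>States are taken to be natural numbers, because HOL cannot quantify over the type of states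
  inside a definition; by \<open>dta_lang_in_RECOG\<close> below this is no restriction.\<close>

definition RECOG :: "'a symbol tree set set" where
  "RECOG = {L. \<exists>M :: (nat, 'a) dta. dta M \<and> L = dta_lang M}"

lemma delta_hat_in_states:
  assumes "dta M" and "t \<in> trees (dta_alphabet M)"
  shows "delta_hat M t \<in> dta_states M"
  using assms(2)
proof (induction rule: trees.induct)
  case (leaf a)
  then show ?case using assms(1) by (simp add: dta_def)
next
  case (node ts k a)
  then have "length (map (delta_hat M) ts) = k" "set (map (delta_hat M) ts) \<subseteq> dta_states M"
    by auto
  then have "dta_delta M a (map (delta_hat M) ts) \<in> dta_states M"
    using assms(1) node unfolding dta_def by blast
  then show ?case using node by auto
qed

lemma dta_lang_in_RECOG:
  fixes M :: "('q, 'a) dta"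
  assumes M: "dta M"
  shows "dta_lang M \<in> RECOG"
proof -
  have "finite (dta_states M)" using M by (simp add: dta_def)
  then obtain f :: "'q \<Rightarrow> nat" where f: "inj_on f (dta_states M)"
    using finite_imp_inj_to_nat_seg by blast
  define g where "g = inv_into (dta_states M) f"
  have gf: "g (f q) = q" if "q \<in> dta_states M" for q
    using that f by (simp add: g_def)
  define M' :: "(nat, 'a) dta" where
    "M' = \<lparr>dta_states = f ` dta_states M, dta_alphabet = dta_alphabet M,
           dta_delta = (\<lambda>a qs. f (dta_delta M a (map g qs))),
           dta_init = (\<lambda>a. f (dta_init M a)), dta_final = f ` dta_final M\<rparr>"
  have "dta_delta M a (map g qs) \<in> dta_states M"
    if "k \<ge> 1" "a \<in> dta_alphabet M k" "length qs = k" "set qs \<subseteq> f ` dta_states M" for k a qs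
  proof -
    have "length (map g qs) = k" "set (map g qs) \<subseteq> dta_states M"
      using that gf by auto
    then show ?thesis using M that unfolding dta_def by blast
  qed
  then have M': "dta M'"
    using M unfolding dta_def M'_def by auto
  have hat: "delta_hat M' t = f (delta_hat M t)" if "t \<in> trees (dta_alphabet M)" for t
    using that
  proof (induction rule: trees.induct)
    case (leaf a)
    then show ?case by (simp add: M'_def)
  next
    case (node ts k a)
    then have *: "map (g \<circ> delta_hat M') ts = map (delta_hat M) ts"
      using gf delta_hat_in_states[OF M] by auto
    have "ts \<noteq> []" using node by auto
    then have "delta_hat M' (Node a ts) = f (dta_delta M a (map (g \<circ> delta_hat M') ts))"
      by (simp add: M'_def)
    then show ?case unfolding * using \<open>ts \<noteq> []\<close> by simp
  qed
  have alph: "dta_alphabet M' = dta_alphabet M" and fin: "dta_final M' = f ` dta_final M"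
    by (simp_all add: M'_def)
  have sub: "dta_final M \<subseteq> dta_states M" using M by (simp add: dta_def)
  have "delta_hat M' t \<in> f ` dta_final M \<longleftrightarrow> delta_hat M t \<in> dta_final M"
    if "t \<in> trees (dta_alphabet M)" for t
    using inj_on_image_mem_iff[OF f delta_hat_in_states[OF M that] sub] hat[OF that] by simp
  then have "dta_lang M = dta_lang M'"
    unfolding dta_lang_def alph fin by blast
  then show ?thesis using M' unfolding RECOG_def by blast
qed


section \<open>Context-free languages\<close>

text \<open>In sentential forms nonterminals are tagged with \<open>Inl\<close> and terminals with \<open>Inr\<close>, which makes
  the two alphabets disjoint.\<close>

record ('n, 'a) cfg =
  cfg_nonterminals :: "'n set"
  cfg_terminals :: "'a set"
  cfg_rules :: "('n \<times> ('n + 'a) list) set"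
  cfg_start :: 'n

definition cfg :: "('n, 'a) cfg \<Rightarrow> bool" where
  "cfg G \<longleftrightarrow>
     finite (cfg_nonterminals G) \<and> finite (cfg_terminals G) \<and> finite (cfg_rules G) \<and>
     (\<forall>(A, \<alpha>)\<in>cfg_rules G. A \<in> cfg_nonterminals G \<and>
        set \<alpha> \<subseteq> cfg_nonterminals G <+> cfg_terminals G) \<and>
     cfg_start G \<in> cfg_nonterminals G"

inductive cfg_step :: "('n, 'a) cfg \<Rightarrow> ('n + 'a) list \<Rightarrow> ('n + 'a) list \<Rightarrow> bool"
  for G :: "('n, 'a) cfg" where
  "(A, \<alpha>) \<in> cfg_rules G \<Longrightarrow> cfg_step G (u @ [Inl A] @ v) (u @ \<alpha> @ v)"

definition cfg_lang :: "('n, 'a) cfg \<Rightarrow> 'a list set" where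
  "cfg_lang G =
     {w \<in> lists (cfg_terminals G). (cfg_step G)\<^sup>*\<^sup>* [Inl (cfg_start G)] (map Inr w)}"

text \<open>As for automata, taking natural numbers as nonterminals is no restriction, by
  \<open>cfg_lang_in_CFL\<close> below.\<close>

definition CFL :: "'a list set set" where
  "CFL = {K. \<exists>G :: (nat, 'a) cfg. cfg G \<and> K = cfg_lang G}"

lemma cfg_steps_map:
  fixes G :: "('n, 'a) cfg" and G' :: "('m, 'a) cfg" and f :: "'n \<Rightarrow> 'm"
  assumes rules: "\<And>A \<alpha>. (A, \<alpha>) \<in> cfg_rules G \<Longrightarrow> (f A, map (map_sum f id) \<alpha>) \<in> cfg_rules G'"
    and "(cfg_step G)\<^sup>*\<^sup>* x y"
  shows "(cfg_step G')\<^sup>*\<^sup>* (map (map_sum f id) x) (map (map_sum f id) y)"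
  using assms(2)
proof (induction rule: rtranclp_induct)
  case base
  show ?case by simp
next
  case (step y z)
  from step(2) have "cfg_step G' (map (map_sum f id) y) (map (map_sum f id) z)"
  proof cases
    case (1 A \<alpha> u v)
    then show ?thesis
      using cfg_step.intros[OF rules[OF 1(3)], of "map (map_sum f id) u" "map (map_sum f id) v"]
      by simp
  qed
  with step.IH show ?case by (rule rtranclp.rtrancl_into_rtrancl)
qed

lemma cfg_lang_in_CFL:
  fixes G :: "('n, 'a) cfg"
  assumes G: "cfg G"
  shows "cfg_lang G \<in> CFL"
proof -
  let ?N = "cfg_nonterminals G"
  have "finite ?N" using G by (simp add: cfg_def)
  then obtain f :: "'n \<Rightarrow> nat" where f: "inj_on f ?N"
    using finite_imp_inj_to_nat_seg by blast
  define g where "g = inv_into ?N f"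
  have gf: "g (f A) = A" if "A \<in> ?N" for A
    using that f by (simp add: g_def)
  define ren where "ren = (\<lambda>(A, \<alpha>). (f A, map (map_sum f (id :: 'a \<Rightarrow> 'a)) \<alpha>))"
  define G' :: "(nat, 'a) cfg" where
    "G' = \<lparr>cfg_nonterminals = f ` ?N, cfg_terminals = cfg_terminals G,
           cfg_rules = ren ` cfg_rules G, cfg_start = f (cfg_start G)\<rparr>"
  have G': "cfg G'"
    using G unfolding cfg_def G'_def ren_def by (fastforce simp: Plus_def)
  have start: "cfg_start G \<in> ?N" using G by (simp add: cfg_def)
  have fwd: "(f A, map (map_sum f id) \<alpha>) \<in> cfg_rules G'" if "(A, \<alpha>) \<in> cfg_rules G" for A \<alpha>
    using that by (force simp: G'_def ren_def)
  have bwd: "(g B, map (map_sum g id) \<beta>) \<in> cfg_rules G" if BG: "(B, \<beta>) \<in> cfg_rules G'" for B \<beta>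
  proof -
    obtain A \<alpha> where A: "(A, \<alpha>) \<in> cfg_rules G" "B = f A" "\<beta> = map (map_sum f id) \<alpha>"
      using BG by (auto simp: G'_def ren_def)
    have "A \<in> ?N" "set \<alpha> \<subseteq> ?N <+> cfg_terminals G"
      using G A(1) by (auto simp: cfg_def)
    then have "g B = A" "map (map_sum g id) \<beta> = \<alpha>"
      using gf A by (auto intro!: map_idI)
    then show ?thesis using A(1) by simp
  qed
  have "(cfg_step G)\<^sup>*\<^sup>* [Inl (cfg_start G)] (map Inr w) \<longleftrightarrow>
        (cfg_step G')\<^sup>*\<^sup>* [Inl (cfg_start G')] (map Inr w)" for w
    using cfg_steps_map[of G f G', OF fwd, of "[Inl (cfg_start G)]" "map Inr w"]
      cfg_steps_map[of G' g G, OF bwd, of "[Inl (cfg_start G')]" "map Inr w"]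
      gf[OF start]
    by (auto simp: G'_def comp_def)
  then have "cfg_lang G = cfg_lang G'"
    unfolding cfg_lang_def by (auto simp: G'_def)
  then show ?thesis using G' unfolding CFL_def by blast
qed

end

(* Derivations of a context-free grammar are captured by a big-step relation whose proofs are
   derivation trees. From an automaton one reads off the grammar whose nonterminals are the states,
   with a rule for every transition. Conversely the derivation trees of a grammar, with each rule
   A -> lambda turned into A[e], have the right yields. The alphabet of strings may be too small to
   label their inner nodes by nonterminals, so all inner nodes carry one fixed symbol instead, and a
   bottom-up subset construction recovers the possible labels. *)
theory Submission
  imports Defs
begin

text \<open>A choice principle: trees found separately for the entries of a right-hand side are
  collected into one list, ready to become the children of a node.\<close>

lemma list_all2_ex_map:
  assumes "list_all2 (\<lambda>x w. \<exists>t. P x t \<and> f t = w) xs ws"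
  shows "\<exists>ts. list_all2 P xs ts \<and> map f ts = ws"
  using assms
proof (induction rule: list_all2_induct)
  case (Cons x xs w ws)
  then obtain t ts where "P x t" "f t = w" "list_all2 P xs ts" "map f ts = ws" by blast
  then show ?case by (intro exI[of _ "t # ts"]) simp
qed simp

lemma yield_Node: "ts \<noteq> [] \<Longrightarrow> yield (Node a ts) = concat (map yield ts)"
  by simp

lemma delta_hat_Node: "ts \<noteq> [] \<Longrightarrow> delta_hat M (Node a ts) = dta_delta M a (map (delta_hat M) ts)"
  by simp

text \<open>From here on leaves and inner nodes are kept apart: leaves have simp rules of their own,
  inner nodes go through the \<open>_Node\<close> equations once \<open>ts \<noteq> []\<close> is
  known.\<close>

declare yield.simps [simp del] delta_hat.simps [simp del]

lemma yield_leaf [simp]: "yield (Node a []) = symbol_word a"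
  by (simp add: yield.simps)

lemma delta_hat_leaf [simp]: "delta_hat M (Node a []) = dta_init M a"
  by (simp add: delta_hat.simps)


section \<open>Derivation trees of context-free grammars\<close>

text \<open>The words \<open>ws\<close> play the part of the yields of a node's children. A terminal
  derives itself even outside \<open>cfg_terminals G\<close>; the restriction to the terminal
  alphabet is made in \<open>cfg_lang\<close>.\<close>

inductive derives :: "('n, 'a) cfg \<Rightarrow> 'n + 'a \<Rightarrow> 'a list \<Rightarrow> bool" for G :: "('n, 'a) cfg" where
  terminal: "derives G (Inr a) [a]"
| rule: "(A, \<alpha>) \<in> cfg_rules G \<Longrightarrow> list_all2 (derives G) \<alpha> ws \<Longrightarrow> derives G (Inl A) (concat ws)"

section \<open>Agreement of derivation trees with rewriting of sentential forms\<close>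

lemma cfg_steps_context:
  assumes "(cfg_step G)\<^sup>*\<^sup>* x y"
  shows "(cfg_step G)\<^sup>*\<^sup>* (u @ x @ v) (u @ y @ v)"
  using assms
proof (induction rule: rtranclp_induct)
  case (step y z)
  from step(2) have "cfg_step G (u @ y @ v) (u @ z @ v)"
  proof cases
    case (1 A \<alpha> u' v')
    then show ?thesis using cfg_step.intros[OF 1(3), of "u @ u'" "v' @ v"] by simp
  qed
  with step.IH show ?case by simp
qed simp

text \<open>The leftmost symbol is rewritten completely first; the others follow, by induction,
  behind its terminal word.\<close>

lemma cfg_steps_concat:
  assumes "list_all2 (\<lambda>X w. (cfg_step G)\<^sup>*\<^sup>* [X] (map Inr w)) \<alpha> ws"
  shows "(cfg_step G)\<^sup>*\<^sup>* \<alpha> (map Inr (concat ws))"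
  using assms
proof (induction rule: list_all2_induct)
  case (Cons X \<alpha> w ws)
  have "(cfg_step G)\<^sup>*\<^sup>* (X # \<alpha>) (map Inr w @ \<alpha>)"
    using cfg_steps_context[OF Cons(1), of "[]" \<alpha>] by simp
  also have "(cfg_step G)\<^sup>*\<^sup>* (map Inr w @ \<alpha>) (map Inr w @ map Inr (concat ws))"
    using cfg_steps_context[OF Cons(3), of "map Inr w" "[]"] by simp
  finally show ?case by simp
qed simp

lemma derives_imp_cfg_steps:
  assumes "derives G X w"
  shows "(cfg_step G)\<^sup>*\<^sup>* [X] (map Inr w)"
  using assms
proof (induction rule: derives.induct)
  case (rule A \<alpha> ws)
  have "cfg_step G [Inl A] \<alpha>"
    using cfg_step.intros[OF rule(1), of "[]" "[]"] by simp
  moreover have "(cfg_step G)\<^sup>*\<^sup>* \<alpha> (map Inr (concat ws))"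
    by (rule cfg_steps_concat, rule list_all2_mono[OF rule(2)]) simp
  ultimately show ?case by simp
qed simp

lemma cfg_steps_imp_derives:
  assumes "(cfg_step G)\<^sup>*\<^sup>* \<alpha> (map Inr w)"
  shows "\<exists>ws. list_all2 (derives G) \<alpha> ws \<and> concat ws = w"
  using assms
proof (induction rule: converse_rtranclp_induct)
  case base
  have "list_all2 (derives G) (map Inr w) (map (\<lambda>a. [a]) w)"
    by (simp add: list_all2_map1 list_all2_map2 list_all2_same derives.terminal)
  then show ?case by (intro exI conjI) auto
next
  case (step x y)
  then obtain ws where ws: "list_all2 (derives G) y ws" "concat ws = w" by blast
  from step(1) show ?case
  proof cases
    case (1 A \<alpha> u v)
    with ws obtain us vs ws' where split: "ws = us @ ws' @ vs"
      "list_all2 (derives G) u us" "list_all2 (derives G) \<alpha> ws'" "list_all2 (derives G) v vs"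
      by (auto simp: list_all2_append1)
    \<comment> \<open>Undoing the first rewriting step: the words of the symbols of \<alpha> merge
      into the single word of \<open>A\<close>, and the context keeps its words.\<close>
    have "list_all2 (derives G) x (us @ [concat ws'] @ vs)"
      unfolding 1 using split derives.rule[OF 1(3)] by (intro list_all2_appendI) auto
    then show ?thesis using split ws by (intro exI conjI) auto
  qed
qed

lemma cfg_lang_derives:
  "cfg_lang G = {w \<in> lists (cfg_terminals G). derives G (Inl (cfg_start G)) w}"
proof -
  have "(cfg_step G)\<^sup>*\<^sup>* [X] (map Inr w) \<longleftrightarrow> derives G X w" for X w
    using cfg_steps_imp_derives[of G "[X]" w] derives_imp_cfg_steps[of G X w]
    by (auto simp: list_all2_Cons1)
  then show ?thesis by (simp add: cfg_lang_def)
qed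


section \<open>From automata to grammars\<close>

text \<open>\<open>Some q\<close> is meant to generate the yields of the trees that evaluate to
  \<open>q\<close>. The fresh start symbol \<open>None\<close> is there because the number of final
  states is arbitrary. For the leaf \<open>Eps\<close> the right-hand side is empty.\<close>

definition dta_grammar :: "('q, 'a) dta \<Rightarrow> ('q option, 'a) cfg" where
  "dta_grammar M =
     \<lparr>cfg_nonterminals = insert None (Some ` dta_states M),
      cfg_terminals = {x. Sym x \<in> dta_alphabet M 0},
      cfg_rules =
        (\<lambda>q. (None, [Inl (Some q)])) ` dta_final M \<union>
        (\<lambda>a. (Some (dta_init M a), map Inr (symbol_word a))) ` dta_alphabet M 0 \<union>
        {(Some (dta_delta M a qs), map (Inl \<circ> Some) qs) | a qs.
           qs \<noteq> [] \<and> a \<in> dta_alphabet M (length qs) \<and> set qs \<subseteq> dta_states M},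
      cfg_start = None\<rparr>"

text \<open>Only finitely many ranks occur, and each admits only finitely many argument lists over
  the finite state set.\<close>

lemma finite_dta_transitions:
  assumes "dta M"
  shows "finite {(a, qs). a \<in> dta_alphabet M (length qs) \<and> set qs \<subseteq> dta_states M}"
proof -
  let ?\<Sigma> = "dta_alphabet M"
  have "finite (dta_states M)" "finite (\<Union>k. ?\<Sigma> k)" "finite {k. ?\<Sigma> k \<noteq> {}}"
    using assms by (auto simp: dta_def ranked_alphabet_def)
  then have "finite ((\<Union>k. ?\<Sigma> k) \<times> (\<Union>k\<in>{k. ?\<Sigma> k \<noteq> {}}. {qs. set qs \<subseteq> dta_states M \<and> length qs = k}))"
    by (intro finite_cartesian_product[OF _ finite_UN_I] finite_lists_length_eq)
  then show ?thesis by (rule rev_finite_subset) auto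
qed

lemma cfg_dta_grammar:
  assumes "dta M"
  shows "cfg (dta_grammar M)"
proof -
  have states: "finite (dta_states M)" "dta_final M \<subseteq> dta_states M"
    and "finite (\<Union>k. dta_alphabet M k)"
    using assms by (simp_all add: dta_def ranked_alphabet_def)
  then have alph: "finite (dta_alphabet M 0)"
    by (blast intro: finite_subset)
  have delta: "dta_delta M a qs \<in> dta_states M"
    if "qs \<noteq> []" "a \<in> dta_alphabet M (length qs)" "set qs \<subseteq> dta_states M" for a qs
  proof -
    have "length qs \<ge> 1" using that(1) by (simp add: Suc_le_eq)
    then show ?thesis using assms that unfolding dta_def by blast
  qed
  have init: "dta_init M a \<in> dta_states M" if "a \<in> dta_alphabet M 0" for a
    using assms that by (simp add: dta_def)
  have word: "set (symbol_word a) \<subseteq> {x. Sym x \<in> dta_alphabet M 0}" if "a \<in> dta_alphabet M 0" for a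
    using that by (cases a) auto
  have "finite {x. Sym x \<in> dta_alphabet M 0}"
    using finite_vimageI[OF alph, of Sym] by (simp add: inj_def vimage_def)
  moreover have "finite (cfg_rules (dta_grammar M))"
  proof -
    have "finite {(Some (dta_delta M a qs), map (Inl \<circ> Some) qs :: ('a option + 'b) list) | a qs.
        qs \<noteq> [] \<and> a \<in> dta_alphabet M (length qs) \<and> set qs \<subseteq> dta_states M}"
      by (rule finite_surj[OF finite_dta_transitions[OF assms],
            of _ "\<lambda>(a, qs). (Some (dta_delta M a qs), map (Inl \<circ> Some) qs)"]) force
    then show ?thesis
      using finite_subset[OF states(2,1)] alph by (simp add: dta_grammar_def)
  qed
  ultimately show ?thesis
    using states delta init word unfolding cfg_def by (fastforce simp: dta_grammar_def)
qed

lemma tree_derives_yield: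
  assumes M: "dta M" and "t \<in> trees (dta_alphabet M)"
  shows "derives (dta_grammar M) (Inl (Some (delta_hat M t))) (yield t)"
  using assms(2)
proof (induction rule: trees.induct)
  case (leaf a)
  let ?G = "dta_grammar M"
  have "(Some (dta_init M a), map Inr (symbol_word a)) \<in> cfg_rules ?G"
    using leaf by (simp add: dta_grammar_def)
  \<comment> \<open>Uniform in \<open>a\<close>: the list is empty for \<open>Eps\<close> and a
    single terminal otherwise.\<close>
  moreover have "list_all2 (derives ?G) (map Inr (symbol_word a)) (map (\<lambda>x. [x]) (symbol_word a))"
    by (simp add: list_all2_map1 list_all2_map2 list_all2_same derives.terminal)
  ultimately have
    "derives ?G (Inl (Some (dta_init M a))) (concat (map (\<lambda>x. [x]) (symbol_word a)))"
    by (rule derives.rule)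
  then show ?case by simp
next
  case (node ts k a)
  let ?G = "dta_grammar M"
  have ts: "ts \<noteq> []" using node by auto
  have "set (map (delta_hat M) ts) \<subseteq> dta_states M"
    using node delta_hat_in_states[OF M] by auto
  then have "(Some (dta_delta M a (map (delta_hat M) ts)),
      map (Inl \<circ> Some) (map (delta_hat M) ts)) \<in> cfg_rules ?G"
    using ts node by (force simp: dta_grammar_def simp del: map_map)
  moreover have
    "list_all2 (derives ?G) (map (Inl \<circ> Some) (map (delta_hat M) ts)) (map yield ts)"
    using node by (simp add: list_all2_map1 list_all2_map2 list_all2_same)
  ultimately show ?case
    unfolding yield_Node[OF ts] delta_hat_Node[OF ts] by (rule derives.rule)
qed

lemma yield_in_lists:
  assumes "t \<in> trees \<Sigma>"
  shows "yield t \<in> lists {x. Sym x \<in> \<Sigma> 0}"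
  using assms
proof (induction rule: trees.induct)
  case (leaf a)
  then show ?case by (cases a) auto
next
  case (node ts k a)
  then have "ts \<noteq> []" by auto
  then show ?case using node by (auto simp: yield_Node in_lists_conv_set)
qed

text \<open>Each rule for \<open>Some q\<close> comes from a leaf or a transition, which supplies
  the root. Stating \<open>X = Inl (Some q)\<close> as a separate premise lets the induction run
  over all symbols and discards terminals and \<open>None\<close>.\<close>

lemma dta_grammar_derives_tree:
  assumes "derives (dta_grammar M) X w" and "X = Inl (Some q)"
  shows "\<exists>t\<in>trees (dta_alphabet M). delta_hat M t = q \<and> yield t = w"
  using assms
proof (induction arbitrary: q rule: derives.induct)
  case (rule A \<alpha> ws)
  from rule(1,3) consider
      a where "a \<in> dta_alphabet M 0" "q = dta_init M a" "\<alpha> = map Inr (symbol_word a)"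
    | a qs where "q = dta_delta M a qs" "\<alpha> = map (Inl \<circ> Some) qs" "qs \<noteq> []"
      "a \<in> dta_alphabet M (length qs)"
    by (auto simp: dta_grammar_def)
  then show ?case
  proof cases
    case 1
    have "concat ws = symbol_word a"
      using rule(2) 1(3) by (cases a) (auto simp: list_all2_Cons1 elim: derives.cases)
    then show ?thesis using 1 by (intro bexI[of _ "Node a []"]) (auto intro: trees.leaf)
  next
    case 2
    have "list_all2 (\<lambda>q w. \<exists>t. (t \<in> trees (dta_alphabet M) \<and> delta_hat M t = q) \<and> yield t = w) qs ws"
      using rule(2) unfolding 2(2) list_all2_map1
      by (rule list_all2_mono) (auto simp: Bex_def)
    from list_all2_ex_map[OF this] obtain ts where
      ts: "list_all2 (\<lambda>q t. t \<in> trees (dta_alphabet M) \<and> delta_hat M t = q) qs ts" "map yield ts = ws"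
      by blast
    then have len: "length ts = length qs" and tr: "\<forall>t\<in>set ts. t \<in> trees (dta_alphabet M)"
      and hat: "map (delta_hat M) ts = qs"
      by (auto simp: list_all2_conv_all_nth in_set_conv_nth intro: nth_equalityI)
    have "ts \<noteq> []" using len 2(3) by auto
    moreover have "Node a ts \<in> trees (dta_alphabet M)"
      using len tr 2 by (intro trees.node[OF len]) (auto simp: Suc_le_eq)
    ultimately show ?thesis using hat ts 2
      by (intro bexI[of _ "Node a ts"]) (auto simp: yield_Node delta_hat_Node)
  qed
qed simp

lemma yield_dta_lang:
  assumes "dta M"
  shows "yield ` dta_lang M = cfg_lang (dta_grammar M)"
proof (intro equalityI subsetI)
  fix w assume "w \<in> yield ` dta_lang M"
  then obtain t where t: "t \<in> trees (dta_alphabet M)" "delta_hat M t \<in> dta_final M" "w = yield t"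
    by (auto simp: dta_lang_def)
  then have "(None, [Inl (Some (delta_hat M t))]) \<in> cfg_rules (dta_grammar M)"
    by (simp add: dta_grammar_def)
  from derives.rule[OF this, of "[w]"] have "derives (dta_grammar M) (Inl None) w"
    using tree_derives_yield[OF assms t(1)] t(3) by simp
  then show "w \<in> cfg_lang (dta_grammar M)"
    using yield_in_lists[OF t(1)] t(3) by (simp add: cfg_lang_derives dta_grammar_def)
next
  fix w assume "w \<in> cfg_lang (dta_grammar M)"
  then have "derives (dta_grammar M) (Inl None) w"
    by (simp add: cfg_lang_derives dta_grammar_def)
  then obtain q where "q \<in> dta_final M" "derives (dta_grammar M) (Inl (Some q)) w"
    by cases (auto simp: dta_grammar_def list_all2_Cons1)
  with dta_grammar_derives_tree show "w \<in> yield ` dta_lang M"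
    by (fastforce simp: dta_lang_def)
qed


section \<open>From grammars to automata\<close>

text \<open>\<open>None\<close> labels the leaf \<open>e\<close> that stands for an empty right-hand side.\<close>

definition rhs_labels :: "('n + 'a) list \<Rightarrow> ('n + 'a) option list" where
  "rhs_labels \<alpha> = (if \<alpha> = [] then [None] else map Some \<alpha>)"

text \<open>A state is the set of all labels that the root of a tree can bear.
  \<open>Sym undefined\<close> is the arbitrary fixed inner symbol; it may coincide with a terminal,
  since a symbol may have several ranks.\<close>

definition cfg_dta :: "('n, 'a) cfg \<Rightarrow> (('n + 'a) option set, 'a) dta" where
  "cfg_dta G =
     (let Q = Pow (insert None (Some ` (cfg_nonterminals G <+> cfg_terminals G))) in
     \<lparr>dta_states = Q,
      dta_alphabet = (\<lambda>k. if k = 0 then insert Eps (Sym ` cfg_terminals G)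
        else if k \<in> (length \<circ> rhs_labels \<circ> snd) ` cfg_rules G then {Sym undefined} else {}),
      dta_delta = (\<lambda>_ qs. {Some (Inl A) | A \<alpha>.
        (A, \<alpha>) \<in> cfg_rules G \<and> list_all2 (\<in>) (rhs_labels \<alpha>) qs}),
      dta_init = (\<lambda>a. case a of Eps \<Rightarrow> {None} | Sym x \<Rightarrow> {Some (Inr x)}),
      dta_final = {q \<in> Q. Some (Inl (cfg_start G)) \<in> q}\<rparr>)"

text \<open>Finitely many rules give finitely many ranks. Transitions stay among the states because
  left-hand sides of rules are nonterminals.\<close>

lemma dta_cfg_dta:
  assumes "cfg G"
  shows "dta (cfg_dta G)"
proof -
  have G: "finite (cfg_nonterminals G)" "finite (cfg_terminals G)" "finite (cfg_rules G)"
    "\<And>A \<alpha>. (A, \<alpha>) \<in> cfg_rules G \<Longrightarrow> A \<in> cfg_nonterminals G"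
    using assms by (auto simp: cfg_def)
  let ?R = "(length \<circ> rhs_labels \<circ> snd) ` cfg_rules G"
  let ?\<Sigma> = "dta_alphabet (cfg_dta G)"
  have "finite (\<Union>k. ?\<Sigma> k)"
    by (rule finite_subset[of _ "insert Eps (insert (Sym undefined) (Sym ` cfg_terminals G))"])
       (use G in \<open>auto simp: cfg_dta_def Let_def split: if_splits\<close>)
  moreover have "finite {k. ?\<Sigma> k \<noteq> {}}"
    by (rule finite_subset[of _ "insert 0 ?R"])
       (use G in \<open>auto simp: cfg_dta_def Let_def split: if_splits\<close>)
  moreover have "\<forall>k\<ge>1. Eps \<notin> ?\<Sigma> k"
    by (simp add: cfg_dta_def Let_def)
  ultimately have "ranked_alphabet ?\<Sigma>"
    by (simp add: ranked_alphabet_def)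
  then show ?thesis
    using G unfolding dta_def by (auto simp: cfg_dta_def Let_def split: symbol.split)
qed

lemma rhs_labels_nonempty: "rhs_labels \<alpha> \<noteq> []"
  by (simp add: rhs_labels_def)

text \<open>Soundness of labels. The conjunct on \<open>None\<close> strengthens the induction: it
  handles the only child of a node that stands for an empty right-hand side.\<close>

lemma cfg_dta_label_derives:
  assumes "t \<in> trees (dta_alphabet (cfg_dta G))"
  shows "(None \<in> delta_hat (cfg_dta G) t \<longrightarrow> yield t = []) \<and>
    (\<forall>X. Some X \<in> delta_hat (cfg_dta G) t \<longrightarrow> derives G X (yield t))"
  using assms
proof (induction rule: trees.induct)
  case (leaf a)
  then show ?case by (cases a) (auto simp: cfg_dta_def Let_def intro: derives.terminal)
next
  case (node ts k a)
  let ?M = "cfg_dta G"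
  have ts: "ts \<noteq> []" using node by auto
  have "derives G X (yield (Node a ts))" if X: "Some X \<in> delta_hat ?M (Node a ts)" for X
  proof -
    obtain A \<alpha> where A: "X = Inl A" "(A, \<alpha>) \<in> cfg_rules G"
      "list_all2 (\<in>) (rhs_labels \<alpha>) (map (delta_hat ?M) ts)"
      using X by (auto simp: delta_hat_Node[OF ts] cfg_dta_def Let_def)
    show ?thesis
    proof (cases "\<alpha> = []")
      case True
      then have "yield (Node a ts) = []"
        using A(3) node(4) by (auto simp: yield_Node[OF ts] rhs_labels_def list_all2_Cons1)
      then show ?thesis
        using derives.rule[OF A(2), of "[]"] True A(1) by simp
    next
      case False
      then have "list_all2 (\<lambda>X t. Some X \<in> delta_hat ?M t) \<alpha> ts"
        using A(3) by (simp add: rhs_labels_def list_all2_map1 list_all2_map2)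
      then have "list_all2 (\<lambda>X t. derives G X (yield t)) \<alpha> ts"
        using node(4) by (auto simp: list_all2_conv_all_nth)
      then show ?thesis
        using derives.rule[OF A(2), of "map yield ts"] A(1)
        by (simp add: yield_Node[OF ts] list_all2_map2)
    qed
  qed
  \<comment> \<open>Transitions produce nonterminal labels only, so the first conjunct is vacuous at
    inner nodes.\<close>
  moreover have "None \<notin> delta_hat ?M (Node a ts)"
    by (simp add: delta_hat_Node[OF ts] cfg_dta_def Let_def)
  ultimately show ?case by blast
qed

text \<open>Completeness of labels, by turning a derivation into a tree. The assumption on
  \<open>w\<close> ensures that its letters are leaf symbols of the automaton; it passes to the
  factors of \<open>w\<close>.\<close>

lemma derives_cfg_dta_tree:
  assumes "derives G X w" and "w \<in> lists (cfg_terminals G)"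
  shows "\<exists>t\<in>trees (dta_alphabet (cfg_dta G)). Some X \<in> delta_hat (cfg_dta G) t \<and> yield t = w"
  using assms
proof (induction rule: derives.induct)
  case (terminal a)
  then show ?case
    by (intro bexI[of _ "Node (Sym a) []"]) (auto simp: cfg_dta_def Let_def intro: trees.leaf)
next
  case (rule A \<alpha> ws)
  let ?M = "cfg_dta G"
  let ?P = "\<lambda>X t. t \<in> trees (dta_alphabet ?M) \<and> X \<in> delta_hat ?M t"
  have "\<exists>ts. list_all2 ?P (rhs_labels \<alpha>) ts \<and> concat (map yield ts) = concat ws"
  proof (cases "\<alpha> = []")
    case True
    have "?P None (Node Eps [])"
      by (auto simp: cfg_dta_def Let_def intro: trees.leaf)
    then show ?thesis
      using True rule(2) by (intro exI[of _ "[Node Eps []]"]) (simp add: rhs_labels_def)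
  next
    case False
    have "\<forall>w\<in>set ws. w \<in> lists (cfg_terminals G)"
      using rule(3) by auto
    with rule(2) have "list_all2 (\<lambda>X w. \<exists>t. ?P (Some X) t \<and> yield t = w) \<alpha> ws"
      by (fastforce simp: list_all2_conv_all_nth)
    from list_all2_ex_map[OF this] show ?thesis
      using False by (auto simp: rhs_labels_def list_all2_map1)
  qed
  then obtain ts where ts: "list_all2 ?P (rhs_labels \<alpha>) ts" "concat (map yield ts) = concat ws"
    by blast
  then have len: "length ts = length (rhs_labels \<alpha>)" and tr: "\<forall>t\<in>set ts. t \<in> trees (dta_alphabet ?M)"
    and lab: "list_all2 (\<in>) (rhs_labels \<alpha>) (map (delta_hat ?M) ts)"
    by (auto simp: list_all2_conv_all_nth in_set_conv_nth)
  have ne: "ts \<noteq> []" using len rhs_labels_nonempty[of \<alpha>] by auto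
  \<comment> \<open>The length is positive, also for an empty right-hand side thanks to its
    \<open>e\<close> leaf, so it falls under the clause for inner ranks.\<close>
  have "Sym undefined \<in> dta_alphabet ?M (length ts)"
    using rule(1) ne unfolding len by (force simp: cfg_dta_def Let_def rhs_labels_nonempty)
  then have "Node (Sym undefined) ts \<in> trees (dta_alphabet ?M)"
    using ne tr by (intro trees.node) (auto simp: Suc_le_eq)
  moreover have "Some (Inl A) \<in> delta_hat ?M (Node (Sym undefined) ts)"
    using rule(1) lab by (auto simp: delta_hat_Node[OF ne] cfg_dta_def Let_def)
  ultimately show ?case using ts(2) yield_Node[OF ne] by metis
qed

lemma yield_cfg_dta:
  assumes "cfg G"
  shows "yield ` dta_lang (cfg_dta G) = cfg_lang G"
proof -
  let ?M = "cfg_dta G"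
  have terminals: "{x. Sym x \<in> dta_alphabet ?M 0} = cfg_terminals G"
    by (auto simp: cfg_dta_def Let_def)
  have "dta_final ?M = {q \<in> dta_states ?M. Some (Inl (cfg_start G)) \<in> q}"
    by (simp add: cfg_dta_def Let_def)
  \<comment> \<open>Every tree evaluates to a state, so acceptance means that the root can bear the
    start symbol.\<close>
  then have lang: "dta_lang ?M =
      {t \<in> trees (dta_alphabet ?M). Some (Inl (cfg_start G)) \<in> delta_hat ?M t}"
    using delta_hat_in_states[OF dta_cfg_dta[OF assms]] by (auto simp: dta_lang_def)
  show ?thesis
  proof (intro equalityI subsetI)
    fix w assume "w \<in> yield ` dta_lang ?M"
    then show "w \<in> cfg_lang G"
      using cfg_dta_label_derives yield_in_lists[of _ "dta_alphabet ?M"]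
      unfolding lang cfg_lang_derives terminals by blast
  next
    fix w assume "w \<in> cfg_lang G"
    then show "w \<in> yield ` dta_lang ?M"
      using derives_cfg_dta_tree unfolding lang cfg_lang_derives by blast
  qed
qed

section \<open>The two inclusions combined\<close>

theorem theorem3p28:
  "(\<lambda>L. yield ` L) ` (RECOG :: 'a symbol tree set set) = CFL"
proof (intro equalityI subsetI)
  fix K :: "'a list set"
  assume "K \<in> (\<lambda>L. yield ` L) ` RECOG"
  then obtain M :: "(nat, 'a) dta" where "dta M" "K = yield ` dta_lang M"
    by (auto simp: RECOG_def)
  then show "K \<in> CFL"
    \<comment> \<open>The nonterminals have type \<open>nat option\<close>; renaming them to natural
      numbers is what \<open>cfg_lang_in_CFL\<close> provides.\<close>
    using cfg_lang_in_CFL[OF cfg_dta_grammar] by (simp add: yield_dta_lang)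
next
  fix K :: "'a list set"
  assume "K \<in> CFL"
  then obtain G :: "(nat, 'a) cfg" where G: "cfg G" "K = cfg_lang G"
    by (auto simp: CFL_def)
  then show "K \<in> (\<lambda>L. yield ` L) ` RECOG"
    \<comment> \<open>Likewise the states, here sets of labels, are renamed to natural
      numbers.\<close>
    using dta_lang_in_RECOG[OF dta_cfg_dta[OF G(1)]] yield_cfg_dta[OF G(1)] by blast
qed

end
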